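(* Let $n \ge 1$ and let $G \sim G(n,1/2)$ be a random graph. Run the following algorithm (Grimmett--McDiarmid heuristic): scan the vertices of $G$ in a uniformly random order, adding a vertex to the current set if it is not adjacent to any vertex added so far. Let $\mathbf{k}$ be the size of the resulting stable set. For integers $k \ge 0$ define \[ p_k = \Pr[\mathbf{k} = k], \qquad q_k = \Pr\left[\frac{n}{2^{k+1}} \leq H < \frac{n}{2^k}\right], \] where $H$ is the random variable defined in the context. Then, as $n \to \infty$, \[ \sum_{k=0}^\infty |p_k - q_k| = o(1). \]
   Context: $H = \sum_{i=1}^\infty E_i$, where $E_1, E_2, \dots$ are independent exponential random variables and $E_i$ has rate $2^i$ (i.e. mean $2^{-i}$); the series converges almost surely. $G(n,1/2)$ is the Erdős–Rényi random graph on $n$ vertices with each edge present independently with probability $1/2$. *)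

theory Defs
  imports "HOL-Probability.Probability"
begin

text \<open>A simple graph on the vertex set \<open>{..<n}\<close> is represented by its set of edges.\<close>

definition all_edges :: "nat \<Rightarrow> nat set set" where
  "all_edges n = {e. e \<subseteq> {..<n} \<and> card e = 2}"

definition erdos_renyi_pmf :: "nat \<Rightarrow> real \<Rightarrow> nat set set pmf" where
  "erdos_renyi_pmf n p =
     map_pmf (\<lambda>X. {e \<in> all_edges n. X e})
       (Pi_pmf (all_edges n) False (\<lambda>_. bernoulli_pmf p))"

definition greedy_step :: "'v set set \<Rightarrow> 'v \<Rightarrow> 'v set \<Rightarrow> 'v set" where
  "greedy_step G v S = (if \<exists>u\<in>S. {u, v} \<in> G then S else insert v S)"

definition greedy_stable_set :: "'v set set \<Rightarrow> 'v list \<Rightarrow> 'v set" where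
  "greedy_stable_set G vs = fold (greedy_step G) vs {}"

definition greedy_size_pmf :: "nat \<Rightarrow> nat pmf" where
  "greedy_size_pmf n =
     do {
       G \<leftarrow> erdos_renyi_pmf n (1 / 2);
       vs \<leftarrow> pmf_of_set (permutations_of_set {..<n});
       return_pmf (card (greedy_stable_set G vs))
     }"

text \<open>The variables are indexed from 1; the value \<open>E 0\<close> is irrelevant. On the null set where
  the series diverges, the value of \<open>exp_series\<close> is unspecified.\<close>

definition exp_series :: "(nat \<Rightarrow> 'a \<Rightarrow> real) \<Rightarrow> 'a \<Rightarrow> real" where
  "exp_series E \<omega> = (\<Sum>i. E (Suc i) \<omega>)"

definition greedy_prob :: "nat \<Rightarrow> nat \<Rightarrow> real" where
  "greedy_prob n k = measure_pmf.prob (greedy_size_pmf n) {k}"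

definition exp_series_prob :: "'a measure \<Rightarrow> (nat \<Rightarrow> 'a \<Rightarrow> real) \<Rightarrow> nat \<Rightarrow> nat \<Rightarrow> real" where
  "exp_series_prob M E n k =
     \<P>(\<omega> in M. real n / 2 ^ (k + 1) \<le> exp_series E \<omega> \<and> exp_series E \<omega> < real n / 2 ^ k)"

end

theory Submission
  imports Defs
begin

text \<open>
  Whatever the vertex order, each new vertex is joined to a current stable set of size \<open>j\<close> by fresh
  edges, so it is added with probability \<open>2\<^sup>-\<^sup>j\<close>. Hence the size reaches \<open>k\<close> within \<open>n\<close> steps iff
  \<open>T\<^sub>k \<le> n\<close>, where \<open>T\<^sub>k\<close> is a sum of independent geometric waiting times of parameters
  \<open>2\<^sup>-\<^sup>j\<close>, \<open>j < k\<close>. Rounding up a rescaled \<open>E\<^sub>i\<close> produces the waiting time with \<open>j = k - i\<close>; this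
  couples \<open>T\<^sub>k / 2\<^sup>k\<close> with \<open>H\<close> at expected distance \<open>O(k / 2\<^sup>k)\<close>. Since the partial sums of \<open>H\<close> have
  density at most 2, \<open>P(T\<^sub>k \<le> n)\<close> and \<open>P(H < n / 2\<^sup>k)\<close> differ by at most some \<open>\<epsilon>\<^sub>k\<close> that does not
  depend on \<open>n\<close> and is summable in \<open>k\<close>. For fixed \<open>k\<close> both tend to 1 as \<open>n \<rightarrow> \<infinity>\<close>, and dominated
  convergence for series gives the claim.
\<close>

subsection \<open>The greedy algorithm as a Markov chain\<close>

lemma finite_all_edges [simp]: "finite (all_edges n)"
  by (rule finite_subset[of _ "Pow {..<n}"]) (auto simp: all_edges_def)

lemma greedy_stable_set_Nil [simp]: "greedy_stable_set G [] = {}"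
  by (simp add: greedy_stable_set_def)

lemma greedy_stable_set_snoc:
  "greedy_stable_set G (vs @ [v]) = greedy_step G v (greedy_stable_set G vs)"
  by (simp add: greedy_stable_set_def)

lemma greedy_stable_set_subset: "greedy_stable_set G vs \<subseteq> set vs"
  by (induction vs rule: rev_induct) (auto simp: greedy_stable_set_snoc greedy_step_def)

text \<open>A scan of \<open>vs\<close> inspects only edges inside \<open>set vs\<close>, so the
  edges at a vertex scanned later are still unrevealed.\<close>

lemma greedy_stable_set_cong:
  assumes "\<And>u v. u \<in> set vs \<Longrightarrow> v \<in> set vs \<Longrightarrow> {u, v} \<in> G \<longleftrightarrow> {u, v} \<in> G'"
  shows "greedy_stable_set G vs = greedy_stable_set G' vs"
  using assms
proof (induction vs rule: rev_induct)
  case (snoc v vs)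
  have "greedy_stable_set G vs = greedy_stable_set G' vs"
    by (rule snoc.IH) (simp add: snoc.prems)
  moreover have "{u, v} \<in> G \<longleftrightarrow> {u, v} \<in> G'" if "u \<in> greedy_stable_set G' vs" for u
    using that greedy_stable_set_subset[of G' vs] snoc.prems by auto
  ultimately show ?case
    by (auto simp: greedy_stable_set_snoc greedy_step_def)
qed auto

primrec greedy_chain :: "nat \<Rightarrow> nat pmf" where
  "greedy_chain 0 = return_pmf 0"
| "greedy_chain (Suc n) =
     greedy_chain n \<bind> (\<lambda>k. map_pmf (\<lambda>b. if b then Suc k else k) (bernoulli_pmf (1 / 2 ^ k)))"

text \<open>Used with \<open>C\<close> the potential edges from a new vertex to the current stable
  set: the vertex is added when all of them are absent.\<close>

lemma all_tails_pmf:
  assumes "finite B" "C \<subseteq> B"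
  shows "map_pmf (\<lambda>g. \<forall>e\<in>C. \<not> g e) (Pi_pmf B False (\<lambda>_. bernoulli_pmf (1 / 2))) =
    bernoulli_pmf (1 / 2 ^ card C)" (is "map_pmf ?f ?P = ?Q")
proof -
  have eq: "?f -` {True} = Pi B (\<lambda>e. if e \<in> C then {False} else UNIV)"
    using assms by (auto simp: Pi_def split: if_splits)
  have "pmf (map_pmf ?f ?P) True = measure_pmf.prob ?P (?f -` {True})"
    by (simp add: pmf_map)
  also have "\<dots> = (\<Prod>e\<in>B. measure_pmf.prob (bernoulli_pmf (1 / 2)) (if e \<in> C then {False} else UNIV))"
    unfolding eq by (rule measure_Pi_pmf_Pi) fact
  also have "\<dots> = (\<Prod>e\<in>B. if e \<in> C then 1 / 2 else 1)"
    by (intro prod.cong) (auto simp: measure_pmf_single)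
  also have "\<dots> = (\<Prod>e\<in>C. 1 / 2)"
    using assms by (simp add: prod.If_cases Int_absorb1)
  also have "\<dots> = pmf ?Q True"
    by (simp add: power_one_over)
  finally have T: "pmf (map_pmf ?f ?P) True = pmf ?Q True" .
  show ?thesis
  proof (rule pmf_eqI)
    fix b show "pmf (map_pmf ?f ?P) b = pmf ?Q b"
      using T by (cases b) (simp_all only: pmf_False_conv_True)
  qed
qed

text \<open>Deferred decisions: the edges at the last vertex \<open>v\<close> are independent of all
  others, and the set built before \<open>v\<close> depends only on the others. Allowing partial
  scans makes induction from the right end possible.\<close>

lemma greedy_card_pmf:
  assumes "distinct vs" "set vs \<subseteq> {..<n}"
  shows "map_pmf (\<lambda>G. card (greedy_stable_set G vs)) (erdos_renyi_pmf n (1 / 2)) =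
    greedy_chain (length vs)"
  using assms
proof (induction vs rule: rev_induct)
  case (snoc v vs)
  define A where "A = {e \<in> all_edges n. v \<notin> e}"
  define B where "B = {e \<in> all_edges n. v \<in> e}"
  let ?P = "\<lambda>A. Pi_pmf A False (\<lambda>_. bernoulli_pmf (1 / 2 :: real))"
  let ?g = "\<lambda>f g :: nat set \<Rightarrow> bool. {e \<in> all_edges n. if e \<in> A then f e else g e}"
  define S where "S = (\<lambda>f. greedy_stable_set {e \<in> A. f e} vs)"
  have AB: "all_edges n = A \<union> B" "A \<inter> B = {}" and fin: "finite A" "finite B"
    by (auto simp: A_def B_def)
  \<comment> \<open>A product over a disjoint union is a pair of independent products:
    \<open>f\<close> decides the edges away from \<open>v\<close>, \<open>g\<close> those at
    \<open>v\<close>.\<close>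
  have er: "erdos_renyi_pmf n (1 / 2) = ?P A \<bind> (\<lambda>f. ?P B \<bind> (\<lambda>g. return_pmf (?g f g)))"
    unfolding erdos_renyi_pmf_def
    by (subst (2) AB(1), subst Pi_pmf_union[OF fin AB(2)])
       (simp add: map_pmf_def pair_pmf_def bind_assoc_pmf bind_return_pmf)
  have eqS: "greedy_stable_set (?g f g) vs = S f" for f g
    unfolding S_def
  proof (rule greedy_stable_set_cong)
    fix u w assume "u \<in> set vs" "w \<in> set vs"
    with snoc.prems have "v \<notin> {u, w}" by auto
    then show "({u, w} \<in> ?g f g) = ({u, w} \<in> {e \<in> A. f e})"
      by (auto simp: A_def)
  qed
  have subS: "S f \<subseteq> set vs" for f
    unfolding S_def by (rule greedy_stable_set_subset)
  have finS: "finite (S f)" for f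
    using subS finite_subset by blast
  have edge: "{u, v} \<in> B" if "u \<in> S f" for u f
    using that subS[of f] snoc.prems by (auto simp: B_def all_edges_def card_insert_if)
  have step: "card (greedy_stable_set (?g f g) (vs @ [v])) =
      (if \<forall>e\<in>(\<lambda>u. {u, v}) ` S f. \<not> g e then Suc (card (S f)) else card (S f))" for f g
  proof -
    have "{u, v} \<in> ?g f g \<longleftrightarrow> g {u, v}" if "u \<in> S f" for u
      using edge[OF that] by (auto simp: A_def B_def)
    moreover have "v \<notin> S f"
      using subS[of f] snoc.prems by auto
    ultimately show ?thesis
      using finS by (auto simp: greedy_stable_set_snoc greedy_step_def eqS)
  qed
  have cardS: "card ((\<lambda>u. {u, v}) ` S f) = card (S f)" for f
    by (rule card_image) (auto simp: inj_on_def doubleton_eq_iff)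
  have chain: "greedy_chain (length vs) = map_pmf (\<lambda>f. card (S f)) (?P A)"
  proof -
    have "greedy_chain (length vs) =
        map_pmf (\<lambda>G. card (greedy_stable_set G vs)) (erdos_renyi_pmf n (1 / 2))"
      using snoc by simp
    also have "\<dots> = map_pmf (\<lambda>f. card (S f)) (?P A)"
      unfolding er by (simp add: map_bind_pmf eqS) (simp add: map_pmf_def)
    finally show ?thesis .
  qed
  have "map_pmf (\<lambda>G. card (greedy_stable_set G (vs @ [v]))) (erdos_renyi_pmf n (1 / 2)) =
      ?P A \<bind> (\<lambda>f. map_pmf (\<lambda>b. if b then Suc (card (S f)) else card (S f))
        (map_pmf (\<lambda>g. \<forall>e\<in>(\<lambda>u. {u, v}) ` S f. \<not> g e) (?P B)))"
    unfolding er by (simp add: map_bind_pmf step map_pmf_comp) (simp add: map_pmf_def)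
  also have "\<dots> = ?P A \<bind> (\<lambda>f. map_pmf (\<lambda>b. if b then Suc (card (S f)) else card (S f))
        (bernoulli_pmf (1 / 2 ^ card (S f))))"
    using edge by (subst all_tails_pmf[OF fin(2)]) (auto simp: cardS)
  also have "\<dots> = greedy_chain (length (vs @ [v]))"
    by (simp add: chain bind_map_pmf)
  finally show ?case .
qed simp

text \<open>The law of the size is the same for every fixed order, so after swapping the two draws
  the permutation integrates out.\<close>

lemma greedy_size_pmf_eq_greedy_chain: "greedy_size_pmf n = greedy_chain n"
proof -
  have perm: "set_pmf (pmf_of_set (permutations_of_set {..<n})) = permutations_of_set {..<n}"
    by (intro set_pmf_of_set) auto
  have "greedy_size_pmf n = pmf_of_set (permutations_of_set {..<n}) \<bind>
      (\<lambda>vs. map_pmf (\<lambda>G. card (greedy_stable_set G vs)) (erdos_renyi_pmf n (1 / 2)))"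
    unfolding greedy_size_pmf_def map_pmf_def by (rule bind_commute_pmf)
  also have "\<dots> = pmf_of_set (permutations_of_set {..<n}) \<bind> (\<lambda>_. greedy_chain n)"
  proof (rule bind_pmf_cong[OF refl])
    fix vs assume "vs \<in> set_pmf (pmf_of_set (permutations_of_set {..<n}))"
    then have "vs \<in> permutations_of_set {..<n}" by (simp add: perm)
    then have vs: "distinct vs" "set vs = {..<n}"
      by (auto simp: permutations_of_set_def)
    then have "length vs = n"
      using distinct_card[of vs] by simp
    with vs show "map_pmf (\<lambda>G. card (greedy_stable_set G vs)) (erdos_renyi_pmf n (1 / 2)) = greedy_chain n"
      using greedy_card_pmf[of vs n] by simp
  qed
  finally show ?thesis by simp
qed

text \<open>Tail probabilities of the chain, as a recursion because sums of independent geometric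
  waiting times satisfy the same one.\<close>

fun reach_prob :: "nat \<Rightarrow> nat \<Rightarrow> real" where
  "reach_prob n 0 = 1"
| "reach_prob 0 (Suc k) = 0"
| "reach_prob (Suc n) (Suc k) =
     (1 - 1 / 2 ^ k) * reach_prob n (Suc k) + 1 / 2 ^ k * reach_prob n k"

lemma prob_greedy_chain_ge: "measure_pmf.prob (greedy_chain n) {k..} = reach_prob n k"
proof (induction n k rule: reach_prob.induct)
  case (3 n k)
  let ?C = "greedy_chain n"
  \<comment> \<open>States above \<open>k\<close> count fully, since the two weights add up to 1;
    the state \<open>k\<close> counts only through an upward step.\<close>
  have bern: "measure_pmf.prob (map_pmf (\<lambda>b. if b then Suc j else j) (bernoulli_pmf (1 / 2 ^ j))) {Suc k..} =
      (1 - 1 / 2 ^ k) * indicator {Suc k..} j + 1 / 2 ^ k * indicator {k..} j" for j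
  proof -
    have "(\<lambda>b. if b then Suc j else j) -` {Suc k..} =
        (if j \<ge> Suc k then UNIV else if j = k then {True} else {})"
      by (auto split: if_splits)
    then show ?thesis
      by (auto simp: measure_pmf_single)
  qed
  have "measure_pmf.prob (greedy_chain (Suc n)) {Suc k..} =
      measure_pmf.expectation ?C (\<lambda>j. measure_pmf.prob
        (map_pmf (\<lambda>b. if b then Suc j else j) (bernoulli_pmf (1 / 2 ^ j))) {Suc k..})"
    unfolding greedy_chain.simps measure_pmf_bind
    by (rule measure_pmf.measure_bind[where N = "count_space UNIV"])
       (auto simp: measure_pmf_in_subprob_algebra)
  also have "\<dots> = measure_pmf.expectation ?C (\<lambda>j.
      (1 - 1 / 2 ^ k) * indicator {Suc k..} j + 1 / 2 ^ k * indicator {k..} j)"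
    unfolding bern ..
  also have "\<dots> = (1 - 1 / 2 ^ k) * measure_pmf.prob ?C {Suc k..} +
      1 / 2 ^ k * measure_pmf.prob ?C {k..}"
    by (simp add: measure_pmf.emeasure_eq_measure)
  finally show ?case
    using 3 by simp
next
  case (1 n) show ?case by (simp)
next
  case (2 k) show ?case by (simp)
qed

lemma greedy_prob_eq: "greedy_prob n k = reach_prob n k - reach_prob n (Suc k)"
proof -
  have "{k} = {k..} - {Suc k..}" by auto
  then show ?thesis
    unfolding greedy_prob_def greedy_size_pmf_eq_greedy_chain
    by (simp only:) (subst measure_pmf.finite_measure_Diff, auto simp: prob_greedy_chain_ge)
qed

subsection \<open>Sums with a geometric or an exponential summand\<close>

text \<open>Memorylessness: the first trial either fails, leaving the same problem with one unit
  less, or succeeds, leaving only \<open>S\<close>. The law of \<open>G\<close> enters through its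
  distribution function, which is what rounding an exponential variable yields.\<close>

lemma (in prob_space) prob_sum_geometric:
  fixes G S :: "'a \<Rightarrow> real"
  assumes ind: "indep_var borel G borel S"
    and nat: "\<And>\<omega>. G \<omega> \<in> \<nat>" and S0: "\<And>\<omega>. S \<omega> \<ge> 0"
    and cdf: "\<And>m::nat. \<P>(\<omega> in M. G \<omega> \<le> real m) = 1 - (1 - p) ^ m"
  shows "\<P>(\<omega> in M. G \<omega> + S \<omega> \<le> 0) = 0"
    and "\<P>(\<omega> in M. G \<omega> + S \<omega> \<le> real (Suc n)) =
      (1 - p) * \<P>(\<omega> in M. G \<omega> + S \<omega> \<le> real n) + p * \<P>(\<omega> in M. S \<omega> \<le> real n)"
proof -
  note [measurable] = indep_var_rv1[OF ind] indep_var_rv2[OF ind]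
  define g where "g m = \<P>(\<omega> in M. G \<omega> = real m)" for m :: nat
  define A where "A m = \<P>(\<omega> in M. S \<omega> \<le> real m)" for m :: nat
  have g0: "g 0 = 0"
  proof -
    have "G \<omega> = real 0 \<longleftrightarrow> G \<omega> \<le> real 0" for \<omega>
      using nat[of \<omega>] by (auto elim!: Nats_cases)
    then have "{\<omega> \<in> space M. G \<omega> = real 0} = {\<omega> \<in> space M. G \<omega> \<le> real 0}"
      by blast
    then show ?thesis using cdf[of 0] by (simp only: g_def) simp
  qed
  have gS: "g (Suc m) = p * (1 - p) ^ m" for m
  proof -
    let ?L = "\<lambda>m. {\<omega> \<in> space M. G \<omega> \<le> real m}"
    have "G \<omega> = real (Suc m) \<longleftrightarrow> G \<omega> \<le> real (Suc m) \<and> \<not> G \<omega> \<le> real m" for \<omega>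
      using nat[of \<omega>] by (auto elim!: Nats_cases)
    then have "{\<omega> \<in> space M. G \<omega> = real (Suc m)} = ?L (Suc m) - ?L m"
      by blast
    moreover have "prob (?L (Suc m) - ?L m) = prob (?L (Suc m)) - prob (?L m)"
      by (rule finite_measure_Diff) (measurable, force)
    ultimately have "g (Suc m) = \<P>(\<omega> in M. G \<omega> \<le> real (Suc m)) - \<P>(\<omega> in M. G \<omega> \<le> real m)"
      unfolding g_def by metis
    then show ?thesis
      unfolding cdf by (simp add: algebra_simps)
  qed
  \<comment> \<open>\<open>G\<close> takes natural values and \<open>S\<close> is nonnegative, so
    the event splits over the values \<open>m\<close> of \<open>G\<close> up to \<open>n\<close>,
    where \<open>n - m\<close> does not truncate.\<close>
  have conv: "\<P>(\<omega> in M. G \<omega> + S \<omega> \<le> real n) = (\<Sum>m\<le>n. g m * A (n - m))" for n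
  proof -
    have "{\<omega> \<in> space M. G \<omega> + S \<omega> \<le> real n} =
        (\<Union>m\<le>n. {\<omega> \<in> space M. G \<omega> = real m \<and> S \<omega> \<le> real (n - m)})"
    proof (intro equalityI subsetI)
      fix \<omega> assume \<omega>: "\<omega> \<in> {\<omega> \<in> space M. G \<omega> + S \<omega> \<le> real n}"
      obtain m where m: "G \<omega> = real m" using nat[of \<omega>] by (auto elim: Nats_cases)
      have "m \<le> n" using \<omega> S0[of \<omega>] m by auto
      then show "\<omega> \<in> (\<Union>m\<le>n. {\<omega> \<in> space M. G \<omega> = real m \<and> S \<omega> \<le> real (n - m)})"
        using \<omega> m by (auto intro!: bexI[of _ m])
    qed auto
    then have "\<P>(\<omega> in M. G \<omega> + S \<omega> \<le> real n) =
        (\<Sum>m\<le>n. \<P>(\<omega> in M. G \<omega> = real m \<and> S \<omega> \<le> real (n - m)))"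
      by (simp only:) (rule finite_measure_finite_Union, auto simp: disjoint_family_on_def)
    also have "\<dots> = (\<Sum>m\<le>n. g m * A (n - m))"
    proof (rule sum.cong[OF refl])
      fix m
      show "\<P>(\<omega> in M. G \<omega> = real m \<and> S \<omega> \<le> real (n - m)) = g m * A (n - m)"
        using prob_indep_random_variable[OF ind, of "{real m}" "{..real (n - m)}"]
        by (simp add: g_def A_def)
    qed
    finally show ?thesis .
  qed
  show "\<P>(\<omega> in M. G \<omega> + S \<omega> \<le> 0) = 0"
    using conv[of 0] by (simp add: g0)
  \<comment> \<open>The mass function shifted by one is \<open>1 - p\<close> times itself plus a
    mass \<open>p\<close> at 0; convolving with \<open>A\<close> gives the claimed
    recursion.\<close>
  have g_step: "g (Suc m) = (1 - p) * g m + (if m = 0 then p else 0)" for m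
    by (cases m) (auto simp: g0 gS)
  have "(\<Sum>m\<le>Suc n. g m * A (Suc n - m)) = (\<Sum>m\<le>n. g (Suc m) * A (n - m))"
    by (subst sum.atMost_Suc_shift) (simp add: g0)
  also have "\<dots> = (\<Sum>m\<le>n. (1 - p) * (g m * A (n - m)) + (if m = 0 then p * A n else 0))"
    by (intro sum.cong) (auto simp: g_step algebra_simps)
  also have "\<dots> = (1 - p) * (\<Sum>m\<le>n. g m * A (n - m)) + p * A n"
    by (simp add: sum.distrib sum_distrib_left)
  finally show "\<P>(\<omega> in M. G \<omega> + S \<omega> \<le> real (Suc n)) =
      (1 - p) * \<P>(\<omega> in M. G \<omega> + S \<omega> \<le> real n) + p * \<P>(\<omega> in M. S \<omega> \<le> real n)"
    unfolding conv by (simp add: A_def)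
qed

text \<open>Adding an independent variable preserves the bound \<open>l\<close> on the density of
  \<open>X\<close>: for each fixed value of \<open>Y\<close>, \<open>X\<close> must fall in an
  interval of length \<open>b - a\<close>.\<close>

lemma (in prob_space) prob_exponential_sum_interval_le:
  fixes X Y :: "'a \<Rightarrow> real"
  assumes X: "distributed M lborel X (exponential_density l)" and l: "l > 0"
    and ind: "indep_var borel X borel Y" and ab: "a \<le> b"
  shows "\<P>(\<omega> in M. a < X \<omega> + Y \<omega> \<and> X \<omega> + Y \<omega> < b) \<le> l * (b - a)"
proof -
  note [measurable] = indep_var_rv1[OF ind] indep_var_rv2[OF ind]
  let ?X = "distr M borel X" and ?Y = "distr M borel Y"
  let ?A = "{z. a < fst z + snd z \<and> fst z + snd z < b} :: (real \<times> real) set"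
  interpret X: prob_space ?X by (rule prob_space_distr) measurable
  interpret Y: prob_space ?Y by (rule prob_space_distr) measurable
  interpret XY: pair_sigma_finite ?X ?Y ..
  have "{z \<in> space (borel \<Otimes>\<^sub>M borel). a < fst z + snd z \<and> fst z + snd z < b} \<in> sets (borel \<Otimes>\<^sub>M borel)"
    by measurable
  then have A: "?A \<in> sets (borel \<Otimes>\<^sub>M borel)"
    by (simp add: space_pair_measure)
  have A': "?A \<in> sets (?X \<Otimes>\<^sub>M ?Y)"
    using A by (subst sets_pair_measure_cong[of _ borel _ borel]) auto
  have slice: "emeasure ?X ((\<lambda>x. (x, y)) -` ?A) \<le> ennreal (l * (b - a))" for y
  proof -
    have "emeasure ?X ((\<lambda>x. (x, y)) -` ?A) = emeasure ?X {a - y<..<b - y}"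
      by (intro arg_cong2[where f = emeasure]) auto
    also have "\<dots> = emeasure M (X -` {a - y<..<b - y} \<inter> space M)"
      by (rule emeasure_distr) auto
    also have "\<dots> = (\<integral>\<^sup>+x. ennreal (exponential_density l x) * indicator {a - y<..<b - y} x \<partial>lborel)"
      by (rule distributed_emeasure[OF X]) auto
    also have "\<dots> \<le> (\<integral>\<^sup>+x. ennreal l * indicator {a - y<..<b - y} x \<partial>lborel)"
      using l by (intro nn_integral_mono mult_right_mono ennreal_leI)
        (auto simp: exponential_density_def)
    also have "\<dots> = ennreal (l * (b - a))"
      using l ab by (simp add: nn_integral_cmult_indicator ennreal_mult)
    finally show ?thesis .
  qed
  have "emeasure M {\<omega> \<in> space M. a < X \<omega> + Y \<omega> \<and> X \<omega> + Y \<omega> < b} =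
      emeasure (distr M (borel \<Otimes>\<^sub>M borel) (\<lambda>\<omega>. (X \<omega>, Y \<omega>))) ?A"
    by (subst emeasure_distr[OF _ A]) (auto intro!: arg_cong[where f = "emeasure M"])
  also have "\<dots> = emeasure (?X \<Otimes>\<^sub>M ?Y) ?A"
    using ind by (simp add: indep_var_distribution_eq)
  also have "\<dots> = (\<integral>\<^sup>+y. emeasure ?X ((\<lambda>x. (x, y)) -` ?A) \<partial>?Y)"
    by (rule XY.emeasure_pair_measure_alt2[OF A'])
  also have "\<dots> \<le> (\<integral>\<^sup>+y. ennreal (l * (b - a)) \<partial>?Y)"
    by (intro nn_integral_mono slice)
  also have "\<dots> = ennreal (l * (b - a))"
    using Y.emeasure_space_1 by (subst nn_integral_const) simp
  finally show ?thesis
    using l ab by (simp add: emeasure_eq_measure)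
qed

lemma (in prob_space) prob_less_tendsto_1:
  fixes X :: "'a \<Rightarrow> real"
  assumes [measurable]: "random_variable borel X" and x: "filterlim x at_top F"
  shows "((\<lambda>n. \<P>(\<omega> in M. X \<omega> < x n)) \<longlongrightarrow> 1) F"
proof (rule tendsto_sandwich[OF _ _ _ tendsto_const])
  interpret D: real_distribution "distr M borel X"
    by (rule real_distribution_distr) measurable
  \<comment> \<open>\<open>cdf\<close> counts the event with \<le>; lowering the threshold by 1
    bounds the strict event from below.\<close>
  have "filterlim (\<lambda>n. x n + (- 1)) at_top F"
    using filterlim_tendsto_add_at_top[OF tendsto_const[of "-1" F] x] by (simp add: add.commute)
  then show "((\<lambda>n. cdf (distr M borel X) (x n + (- 1))) \<longlongrightarrow> 1) F"
    by (rule filterlim_compose[OF D.cdf_lim_at_top_prob])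
  have "cdf (distr M borel X) (x n + (- 1)) \<le> \<P>(\<omega> in M. X \<omega> < x n)" for n
    unfolding cdf_def by (subst measure_distr) (auto intro!: finite_measure_mono)
  then show "\<forall>\<^sub>F n in F. cdf (distr M borel X) (x n + (- 1)) \<le> \<P>(\<omega> in M. X \<omega> < x n)"
    by (intro always_eventually) auto
qed (auto intro!: always_eventually)

subsection \<open>Coupling of the waiting times with the exponential series\<close>

text \<open>
  If \<open>Z\<close> is exponential of rate 1, then \<open>\<lceil>Z / r\<rceil>\<close> is geometric of parameter \<open>1 - exp (- r)\<close>; here
  \<open>Z = 2 ^ i * E i\<close> and the parameter is \<open>2 ^ - (k - i)\<close>. For \<open>i = k\<close> the parameter is 1 and \<open>r\<close>
  would be infinite, which \<open>ln 0 = 0\<close> does not reflect.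
\<close>

definition waiting_time :: "nat \<Rightarrow> nat \<Rightarrow> real \<Rightarrow> real" where
  "waiting_time k i x =
     (if i = k then 1 else real (nat \<lceil>2 ^ i * x / - ln (1 - 1 / 2 ^ (k - i))\<rceil>))"

lemma waiting_time_Nats: "waiting_time k i x \<in> \<nat>"
  by (simp add: waiting_time_def)

lemma waiting_time_nonneg: "waiting_time k i x \<ge> 0"
  by (simp add: waiting_time_def)

lemma borel_measurable_waiting_time [measurable]: "waiting_time k i \<in> borel_measurable borel"
proof (cases "i = k")
  case False
  have "(\<lambda>x::real. real (nat \<lceil>2 ^ i * x / - ln (1 - 1 / 2 ^ (k - i))\<rceil>)) \<in> borel_measurable borel"
    by measurable
  with False show ?thesis by (simp add: waiting_time_def[abs_def])
qed (simp add: waiting_time_def[abs_def])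

text \<open>Both bounds come from \<open>ln y \<le> y - 1\<close>, at \<open>1 - p\<close> and at
  \<open>1 / (1 - p)\<close>. They control the error of replacing \<open>- ln (1 - p)\<close> by
  \<open>p\<close>.\<close>

lemma neg_ln_one_minus_bounds:
  fixes p :: real
  assumes "0 < p" "p < 1"
  shows "p \<le> - ln (1 - p)" "- ln (1 - p) \<le> p / (1 - p)"
proof -
  show "p \<le> - ln (1 - p)"
    using ln_le_minus_one[of "1 - p"] assms by simp
  have "- ln (1 - p) = ln (1 / (1 - p))"
    using assms by (simp add: ln_div)
  also have "\<dots> \<le> 1 / (1 - p) - 1"
    using assms by (intro ln_le_minus_one) auto
  also have "\<dots> = p / (1 - p)"
    using assms by (simp add: field_simps)
  finally show "- ln (1 - p) \<le> p / (1 - p)" .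
qed

text \<open>For \<open>i < k\<close> put \<open>z = 2 ^ i * x\<close> and
  \<open>p = 1 / 2 ^ (k - i)\<close>, so that \<open>2 ^ k * x = z / p\<close>. Dividing
  \<open>z\<close> by \<open>- ln (1 - p)\<close> instead of \<open>p\<close> loses at most
  \<open>z\<close>, and rounding up adds at most 1.\<close>

lemma waiting_time_approx:
  assumes "x \<ge> 0" "i \<le> k"
  shows "\<bar>waiting_time k i x - 2 ^ k * x\<bar> \<le> 1 + 2 ^ i * x"
proof (cases "i = k")
  case True
  have "2 ^ k * x \<ge> 0" using assms by simp
  with True show ?thesis by (simp add: waiting_time_def)
next
  case False
  define p :: real where "p = 1 / 2 ^ (k - i)"
  define r where "r = - ln (1 - p)"
  define z where "z = 2 ^ i * x"
  have p: "0 < p" "p < 1"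
    using False assms by (auto simp: p_def)
  have z: "z \<ge> 0" using assms by (simp add: z_def)
  have r: "p \<le> r" "r \<le> p / (1 - p)"
    using neg_ln_one_minus_bounds[OF p] by (auto simp: r_def)
  then have r0: "r > 0" using p by linarith
  have zk: "2 ^ k * x = z / p"
    using assms by (simp add: z_def p_def flip: power_add)
  have up: "z / r \<le> z / p"
    using r p z by (intro divide_left_mono) auto
  have "r * (1 - p) \<le> p" using r(2) p by (simp add: field_simps)
  then have "z * (r * (1 - p)) \<le> z * p" using z by (rule mult_left_mono)
  then have lo: "z / p - z \<le> z / r"
    using p r0 by (simp add: field_simps)
  have w: "waiting_time k i x = real (nat \<lceil>z / r\<rceil>)"
    using False by (simp add: waiting_time_def z_def r_def p_def)
  have "z / r \<ge> 0" using z r0 by simp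
  then have "z / r \<le> waiting_time k i x" "waiting_time k i x \<le> z / r + 1"
    unfolding w by linarith+
  with up lo z show ?thesis
    unfolding zk z_def[symmetric] by linarith
qed

locale dyadic_exponentials = prob_space M for M :: "'a measure" +
  fixes E :: "nat \<Rightarrow> 'a \<Rightarrow> real"
  assumes indep: "indep_vars (\<lambda>_. borel) E {1..}"
    and exponential: "i \<ge> 1 \<Longrightarrow> distributed M lborel (E i) (exponential_density (2 ^ i))"
begin

lemma measurable_E: "i \<ge> 1 \<Longrightarrow> E i \<in> borel_measurable M"
  using distributed_measurable[OF exponential] by simp

lemma measurable_E_Suc [measurable]: "E (Suc i) \<in> borel_measurable M"
  by (rule measurable_E) simp

lemma measurable_exp_series [measurable]: "exp_series E \<in> borel_measurable M"
  unfolding exp_series_def[abs_def] by measurable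

text \<open>For \<open>i < k\<close> the event says that the rate 1 exponential
  \<open>2 ^ i * E i\<close> is at most \<open>m * r\<close>; its complement has probability
  \<open>exp (- m * r) = (1 - p) ^ m\<close> because \<open>r = - ln (1 - p)\<close>.\<close>

lemma prob_waiting_time_le:
  assumes "1 \<le> i" "i \<le> k"
  shows "\<P>(\<omega> in M. waiting_time k i (E i \<omega>) \<le> real m) = 1 - (1 - 1 / 2 ^ (k - i)) ^ m"
proof (cases "i = k")
  \<comment> \<open>The waiting time is the constant 1; at \<open>m = 0\<close> the formula gives 0
    thanks to \<open>0 ^ 0 = 1\<close>.\<close>
  case True
  then show ?thesis
    by (cases m) (auto simp: waiting_time_def prob_space)
next
  case False
  define p :: real where "p = 1 / 2 ^ (k - i)"
  define r where "r = - ln (1 - p)"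
  have p: "0 < p" "p < 1"
    using False assms by (auto simp: p_def)
  have r: "r > 0"
    using neg_ln_one_minus_bounds[OF p] p by (auto simp: r_def)
  have "waiting_time k i x \<le> real m \<longleftrightarrow> x \<le> real m * r / 2 ^ i" for x
  proof -
    have "waiting_time k i x \<le> real m \<longleftrightarrow> 2 ^ i * x / r \<le> real m"
      using False by (simp add: waiting_time_def r_def p_def nat_le_iff ceiling_le_iff)
    also have "\<dots> \<longleftrightarrow> x \<le> real m * r / 2 ^ i"
      using r by (simp add: field_simps)
    finally show ?thesis .
  qed
  then have "\<P>(\<omega> in M. waiting_time k i (E i \<omega>) \<le> real m) = \<P>(\<omega> in M. E i \<omega> \<le> real m * r / 2 ^ i)"
    by simp
  also have "\<dots> = 1 - exp (- (real m * r / 2 ^ i) * 2 ^ i)"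
    using assms r by (intro exponential_distributedD_le[OF exponential]) auto
  also have "\<dots> = 1 - exp (real m * ln (1 - p))"
    by (simp add: r_def)
  also have "\<dots> = 1 - (1 - p) ^ m"
    using p by (simp add: exp_of_nat_mult)
  finally show ?thesis by (simp add: p_def)
qed

lemma indep_waiting_time:
  "indep_vars (\<lambda>_. borel) (\<lambda>i \<omega>. waiting_time k i (E i \<omega>)) {1..}"
  by (rule indep_vars_compose2[OF indep]) (rule borel_measurable_waiting_time)

text \<open>Index \<open>i\<close> has parameter \<open>1 / 2 ^ (k - i)\<close>, so the top
  \<open>l\<close> indices carry the parameters \<open>1 / 2 ^ j\<close> with \<open>j < l\<close>.
  Extending the sum downwards adds parameter \<open>1 / 2 ^ l\<close>, which matches the recursion
  of \<open>reach_prob\<close>.\<close>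

lemma prob_sum_waiting_time_le:
  assumes "l \<le> k"
  shows "\<P>(\<omega> in M. (\<Sum>i\<in>{Suc (k - l)..k}. waiting_time k i (E i \<omega>)) \<le> real n) = reach_prob n l"
  using assms
proof (induction l arbitrary: n)
  case 0
  then show ?case by (simp add: prob_space)
next
  case (Suc l)
  define i where "i = k - l"
  define G where "G = (\<lambda>\<omega>. waiting_time k i (E i \<omega>))"
  define S where "S = (\<lambda>\<omega>. \<Sum>i\<in>{Suc i..k}. waiting_time k i (E i \<omega>))"
  have i: "1 \<le> i" "i \<le> k" "k - i = l" "Suc (k - Suc l) = i"
    using Suc.prems by (auto simp: i_def)
  have ind: "indep_var borel G borel S"
    unfolding G_def S_def
    using i by (intro indep_vars_sum indep_vars_subset[OF indep_waiting_time]) auto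
  have nn: "S \<omega> \<ge> 0" for \<omega>
    unfolding S_def by (intro sum_nonneg waiting_time_nonneg)
  have cdf: "\<P>(\<omega> in M. G \<omega> \<le> real m) = 1 - (1 - 1 / 2 ^ l) ^ m" for m
    using prob_waiting_time_le[OF i(1,2)] i by (simp add: G_def)
  have split: "(\<Sum>i\<in>{Suc (k - Suc l)..k}. waiting_time k i (E i \<omega>)) = G \<omega> + S \<omega>" for \<omega>
    unfolding i G_def S_def using i(2) by (rule sum.atLeast_Suc_atMost)
  have IH: "\<P>(\<omega> in M. S \<omega> \<le> real n) = reach_prob n l" for n
    using Suc by (simp add: S_def i_def)
  have "G \<omega> \<in> \<nat>" for \<omega>
    unfolding G_def by (rule waiting_time_Nats)
  note geo = prob_sum_geometric[OF ind this nn cdf]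
  show ?case
    unfolding split
  proof (induction n)
    case 0
    show ?case using geo(1) by simp
  next
    case (Suc n)
    show ?case unfolding geo(2) Suc.IH IH by simp
  qed
qed

section \<open>Moments and almost sure convergence of the exponential series\<close>

lemma integrable_E: "i \<ge> 1 \<Longrightarrow> integrable M (E i)"
  and expectation_E: "i \<ge> 1 \<Longrightarrow> expectation (E i) = 1 / 2 ^ i"
proof -
  assume i: "i \<ge> 1"
  show ex: "expectation (E i) = 1 / 2 ^ i"
    by (rule exponential_distributed_expectation[OF _ exponential[OF i]]) simp
  \<comment> \<open>A function that is not integrable has integral 0 by convention, contradicting
    the positive value just found.\<close>
  show "integrable M (E i)"
    by (rule ccontr) (use ex in \<open>simp add: not_integrable_integral_eq\<close>)
qed

lemma AE_E_nonneg: "AE \<omega> in M. \<forall>i. E (Suc i) \<omega> \<ge> 0"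
proof -
  have "AE \<omega> in M. E (Suc i) \<omega> \<ge> 0" for i
  proof -
    have "\<P>(\<omega> in M. 0 < E (Suc i) \<omega>) = exp (- 0 * 2 ^ Suc i)"
      by (rule exponential_distributedD_gt[OF exponential]) auto
    then have "AE \<omega> in M. 0 < E (Suc i) \<omega>"
      by (intro AE_I_eq_1) (auto simp: emeasure_eq_measure)
    then show ?thesis by eventually_elim simp
  qed
  then show ?thesis by (simp add: AE_all_countable)
qed

text \<open>The expectations have a finite sum, so by monotone convergence the sum of the almost
  surely nonnegative terms is finite almost everywhere.\<close>

lemma AE_summable_E: "AE \<omega> in M. summable (\<lambda>i. E (Suc i) \<omega>)"
proof -
  have "(\<integral>\<^sup>+\<omega>. (\<Sum>i. ennreal (E (Suc i) \<omega>)) \<partial>M) = (\<Sum>i. \<integral>\<^sup>+\<omega>. ennreal (E (Suc i) \<omega>) \<partial>M)"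
    by (rule nn_integral_suminf) measurable
  also have "\<dots> = (\<Sum>i. ennreal (1 / 2 ^ Suc i))"
  proof (rule suminf_cong)
    fix i
    have "AE \<omega> in M. 0 \<le> E (Suc i) \<omega>" using AE_E_nonneg by auto
    then show "(\<integral>\<^sup>+\<omega>. ennreal (E (Suc i) \<omega>) \<partial>M) = ennreal (1 / 2 ^ Suc i)"
      using expectation_E[of "Suc i"] integrable_E[of "Suc i"]
      by (subst nn_integral_eq_integral) auto
  qed
  also have "\<dots> = ennreal (\<Sum>i. 1 / 2 ^ Suc i)"
    using power_half_series by (intro suminf_ennreal2) (auto simp: power_one_over sums_iff)
  finally have "(\<integral>\<^sup>+\<omega>. (\<Sum>i. ennreal (E (Suc i) \<omega>)) \<partial>M) \<noteq> \<infinity>" by simp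
  then have "AE \<omega> in M. (\<Sum>i. ennreal (E (Suc i) \<omega>)) \<noteq> \<infinity>"
    by (intro nn_integral_PInf_AE) measurable
  with AE_E_nonneg show ?thesis
    by eventually_elim (auto intro: summable_suminf_not_top)
qed

lemma integrable_exp_series: "integrable M (exp_series E)"
  and expectation_exp_series: "expectation (exp_series E) = 1"
proof -
  have norm: "AE \<omega> in M. summable (\<lambda>i. norm (E (Suc i) \<omega>))"
    using AE_E_nonneg AE_summable_E by eventually_elim simp
  have "(\<integral>\<omega>. norm (E (Suc i) \<omega>) \<partial>M) = 1 / 2 ^ Suc i" for i
  proof -
    have "(\<integral>\<omega>. norm (E (Suc i) \<omega>) \<partial>M) = expectation (E (Suc i))"
      by (rule integral_cong_AE) (use AE_E_nonneg in auto)
    then show ?thesis using expectation_E[of "Suc i"] by simp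
  qed
  then have sum: "summable (\<lambda>i. \<integral>\<omega>. norm (E (Suc i) \<omega>) \<partial>M)"
    using power_half_series by (simp add: power_one_over sums_iff)
  have int: "integrable M (E (Suc i))" for i
    by (rule integrable_E) simp
  show "integrable M (exp_series E)"
    unfolding exp_series_def[abs_def] by (rule integrable_suminf[OF int norm sum])
  have "expectation (exp_series E) = (\<Sum>i. expectation (E (Suc i)))"
    unfolding exp_series_def[abs_def] by (rule integral_suminf[OF int norm sum])
  also have "\<dots> = (\<Sum>i. (1 / 2) ^ Suc i)"
    by (intro suminf_cong) (subst expectation_E, auto simp: power_one_over)
  also have "\<dots> = 1"
    using power_half_series by (rule sums_unique[symmetric])
  finally show "expectation (exp_series E) = 1" .
qed

end

text \<open>Meant for \<open>C\<close> the event of a large coupling error and \<open>D\<close> the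
  event that a partial sum lies close to the threshold.\<close>

lemma (in prob_space) abs_prob_diff_le:
  assumes [measurable]: "A \<in> events" "B \<in> events" "C \<in> events" "D \<in> events"
    and AB: "AE \<omega> in M. (\<omega> \<in> A) \<noteq> (\<omega> \<in> B) \<longrightarrow> \<omega> \<in> C \<union> D"
  shows "\<bar>prob A - prob B\<bar> \<le> prob C + prob D"
proof -
  have "prob A \<le> prob (B \<union> (C \<union> D))"
    by (rule finite_measure_mono_AE) (use AB in auto)
  moreover have "prob B \<le> prob (A \<union> (C \<union> D))"
    by (rule finite_measure_mono_AE) (use AB in auto)
  moreover have "prob (B \<union> (C \<union> D)) \<le> prob B + prob (C \<union> D)"
    "prob (A \<union> (C \<union> D)) \<le> prob A + prob (C \<union> D)" "prob (C \<union> D) \<le> prob C + prob D"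
    by (auto intro!: measure_Un_le)
  ultimately show ?thesis by linarith
qed

section \<open>Quantitative comparison of the waiting times with the series\<close>

context dyadic_exponentials
begin

text \<open>\<open>E 1\<close> has density at most 2 and is independent of the other summands, which
  makes the bound uniform in \<open>k\<close>.\<close>

lemma prob_partial_sum_interval_le:
  assumes "k \<ge> 1" "a \<le> b"
  shows "\<P>(\<omega> in M. a < (\<Sum>i=1..k. E i \<omega>) \<and> (\<Sum>i=1..k. E i \<omega>) < b) \<le> 2 * (b - a)"
proof -
  have "indep_var borel (E 1) borel (\<lambda>\<omega>. \<Sum>i\<in>{Suc 1..k}. E i \<omega>)"
    by (intro indep_vars_sum indep_vars_subset[OF indep]) auto
  moreover have "(\<Sum>i=1..k. E i \<omega>) = E 1 \<omega> + (\<Sum>i\<in>{Suc 1..k}. E i \<omega>)" for \<omega>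
    using assms by (intro sum.atLeast_Suc_atMost)
  ultimately show ?thesis
    using prob_exponential_sum_interval_le[OF exponential[of 1], of "\<lambda>\<omega>. \<Sum>i\<in>{Suc 1..k}. E i \<omega>" a b] assms
    by simp
qed

text \<open>One variable to dominate both distances to the partial sum: the first two terms add up
  the bounds of \<open>waiting_time_approx\<close>, divided by \<open>2 ^ k\<close>; the last is the
  tail of the series.\<close>

definition coupling_error :: "nat \<Rightarrow> 'a \<Rightarrow> real" where
  "coupling_error k \<omega> = real k / 2 ^ k + (\<Sum>i=1..k. 2 ^ i * E i \<omega>) / 2 ^ k +
     (exp_series E \<omega> - (\<Sum>i=1..k. E i \<omega>))"

lemma integrable_coupling_error: "integrable M (coupling_error k)"
  unfolding coupling_error_def[abs_def]
  by (intro Bochner_Integration.integrable_add Bochner_Integration.integrable_diff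
      integrable_divide_zero Bochner_Integration.integrable_sum integrable_mult_right
      integrable_exp_series integrable_E integrable_const) auto

text \<open>Each \<open>2 ^ i * E i\<close> has mean 1, so the first two terms contribute
  \<open>k / 2 ^ k\<close> each, and the tail has mean \<open>1 / 2 ^ k\<close>.\<close>

lemma expectation_coupling_error: "expectation (coupling_error k) = (2 * real k + 1) / 2 ^ k"
proof -
  have int: "integrable M (E i)" "expectation (E i) = 1 / 2 ^ i" if "i \<in> {1..k}" for i
    using that integrable_E expectation_E by auto
  have sums: "integrable M (\<lambda>\<omega>. \<Sum>i=1..k. c i * E i \<omega>)"
    "expectation (\<lambda>\<omega>. \<Sum>i=1..k. c i * E i \<omega>) = (\<Sum>i=1..k. c i * expectation (E i))" for c
    using int(1) by (auto simp: Bochner_Integration.integral_sum)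
  have "expectation (coupling_error k) =
      real k / 2 ^ k + (\<Sum>i=1..k. 2 ^ i * expectation (E i)) / 2 ^ k +
      (expectation (exp_series E) - (\<Sum>i=1..k. expectation (E i)))"
    unfolding coupling_error_def[abs_def]
    using sums[of "\<lambda>i. 2 ^ i"] sums[of "\<lambda>_. 1"] integrable_exp_series by (simp add: prob_space)
  also have "(\<Sum>i=1..k. 2 ^ i * expectation (E i)) = (\<Sum>i=1..k. 1)"
    by (intro sum.cong) (auto simp: int)
  also have "(\<Sum>i=1..k. expectation (E i)) = (\<Sum>i=1..k. 1 / 2 ^ i)"
    by (intro sum.cong) (auto simp: int)
  also have "(\<Sum>i=1..k. 1 / 2 ^ i :: real) = 1 - 1 / 2 ^ k"
    by (induction k) auto
  finally show ?thesis
    by (simp add: expectation_exp_series field_simps)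
qed

lemma AE_coupling_error:
  "AE \<omega> in M.
     \<bar>(\<Sum>i=1..k. waiting_time k i (E i \<omega>)) / 2 ^ k - (\<Sum>i=1..k. E i \<omega>)\<bar> \<le> coupling_error k \<omega> \<and>
     \<bar>exp_series E \<omega> - (\<Sum>i=1..k. E i \<omega>)\<bar> \<le> coupling_error k \<omega>"
  using AE_E_nonneg AE_summable_E
proof eventually_elim
  case (elim \<omega>)
  have nn: "E i \<omega> \<ge> 0" if "i \<in> {1..k}" for i
    using that elim(1) by (cases i) auto
  have "\<bar>(\<Sum>i=1..k. waiting_time k i (E i \<omega>)) - (\<Sum>i=1..k. 2 ^ k * E i \<omega>)\<bar> \<le>
      (\<Sum>i=1..k. \<bar>waiting_time k i (E i \<omega>) - 2 ^ k * E i \<omega>\<bar>)"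
    unfolding sum_subtractf[symmetric] by (rule sum_abs)
  also have "\<dots> \<le> (\<Sum>i=1..k. 1 + 2 ^ i * E i \<omega>)"
    using nn by (intro sum_mono waiting_time_approx) auto
  also have "\<dots> = real k + (\<Sum>i=1..k. 2 ^ i * E i \<omega>)"
    by (simp add: sum.distrib)
  finally have le: "\<bar>(\<Sum>i=1..k. waiting_time k i (E i \<omega>)) - 2 ^ k * (\<Sum>i=1..k. E i \<omega>)\<bar> / 2 ^ k \<le>
      (real k + (\<Sum>i=1..k. 2 ^ i * E i \<omega>)) / 2 ^ k"
    by (intro divide_right_mono) (auto simp: sum_distrib_left)
  have "\<bar>(\<Sum>i=1..k. waiting_time k i (E i \<omega>)) / 2 ^ k - (\<Sum>i=1..k. E i \<omega>)\<bar> =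
      \<bar>((\<Sum>i=1..k. waiting_time k i (E i \<omega>)) - 2 ^ k * (\<Sum>i=1..k. E i \<omega>)) / 2 ^ k\<bar>"
    by (simp add: diff_divide_distrib)
  also have "\<dots> \<le> real k / 2 ^ k + (\<Sum>i=1..k. 2 ^ i * E i \<omega>) / 2 ^ k"
    using le by (simp add: abs_divide add_divide_distrib)
  finally have 1: "\<bar>(\<Sum>i=1..k. waiting_time k i (E i \<omega>)) / 2 ^ k - (\<Sum>i=1..k. E i \<omega>)\<bar> \<le>
      real k / 2 ^ k + (\<Sum>i=1..k. 2 ^ i * E i \<omega>) / 2 ^ k" .
  have "(\<Sum>i=1..k. E i \<omega>) = (\<Sum>i<k. E (Suc i) \<omega>)"
    by (simp add: sum.atLeast1_atMost_eq)
  also have "\<dots> \<le> exp_series E \<omega>"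
    unfolding exp_series_def using elim by (intro sum_le_suminf) auto
  finally have 2: "(\<Sum>i=1..k. E i \<omega>) \<le> exp_series E \<omega>" .
  \<comment> \<open>The rounding part and the tail are both nonnegative, so their sum bounds each
    distance separately.\<close>
  have "0 \<le> real k / 2 ^ k + (\<Sum>i=1..k. 2 ^ i * E i \<omega>) / 2 ^ k"
    using nn by (intro add_nonneg_nonneg divide_nonneg_nonneg sum_nonneg mult_nonneg_nonneg) auto
  with 1 2 show ?case
    unfolding coupling_error_def by linarith
qed

lemma measurable_sum_E [measurable]: "(\<lambda>\<omega>. \<Sum>i=1..k. E i \<omega>) \<in> borel_measurable M"
  by (intro borel_measurable_sum measurable_E) auto

lemma measurable_sum_waiting_time [measurable]:
  "(\<lambda>\<omega>. \<Sum>i=1..k. waiting_time k i (E i \<omega>)) \<in> borel_measurable M"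
  by (intro borel_measurable_sum measurable_compose[OF measurable_E borel_measurable_waiting_time]) auto

lemma reach_prob_eq: "reach_prob n k = \<P>(\<omega> in M. (\<Sum>i=1..k. waiting_time k i (E i \<omega>)) \<le> real n)"
  using prob_sum_waiting_time_le[of k k n] by simp

text \<open>If the rescaled waiting time and the series lie on different sides of the threshold, the
  coupling error is large or the partial sum is near the threshold. Markov's inequality handles the
  first event, the density bound the second. The result is free of \<open>n\<close>, as domination
  will require.\<close>

lemma reach_prob_approx:
  "\<bar>reach_prob n k - \<P>(\<omega> in M. exp_series E \<omega> < real n / 2 ^ k)\<bar> \<le>
     (2 * real k + 1) * (3 / 4) ^ k + 4 * (2 / 3) ^ k"
proof (cases "k = 0")
  \<comment> \<open>For \<open>k = 0\<close> the partial sum is empty and has no density, but the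
    right-hand side is 5.\<close>
  case True
  define q where "q = \<P>(\<omega> in M. exp_series E \<omega> < real n / 2 ^ k)"
  have "0 \<le> q" "q \<le> 1"
    by (simp_all add: q_def)
  with True show ?thesis
    unfolding q_def[symmetric] by simp
next
  case False
  \<comment> \<open>Any base strictly between 1/2 and 1 makes both the Markov term \<open>O(k / (2 ^ k * \<eta>))\<close> and the
    density term \<open>4 * \<eta>\<close> summable.\<close>
  define \<eta> :: real where "\<eta> = (2 / 3) ^ k"
  define x where "x = real n / 2 ^ k"
  define T where "T = (\<lambda>\<omega>. \<Sum>i=1..k. waiting_time k i (E i \<omega>))"
  define S where "S = (\<lambda>\<omega>. \<Sum>i=1..k. E i \<omega>)"
  have [measurable]: "T \<in> borel_measurable M" "S \<in> borel_measurable M"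
    unfolding T_def S_def by (rule measurable_sum_waiting_time measurable_sum_E)+
  have \<eta>: "\<eta> > 0" by (simp add: \<eta>_def)
  have [measurable]: "coupling_error k \<in> borel_measurable M"
    using integrable_coupling_error by (rule borel_measurable_integrable)
  have pos: "AE \<omega> in M. 0 \<le> coupling_error k \<omega>"
    using AE_coupling_error[of k] by eventually_elim linarith
  have T: "T \<omega> \<le> real n \<longleftrightarrow> T \<omega> / 2 ^ k \<le> x" for \<omega>
    by (simp add: x_def divide_le_cancel)
  have "\<bar>\<P>(\<omega> in M. T \<omega> \<le> real n) - \<P>(\<omega> in M. exp_series E \<omega> < x)\<bar> \<le>
      \<P>(\<omega> in M. coupling_error k \<omega> \<ge> \<eta>) + \<P>(\<omega> in M. x - \<eta> < S \<omega> \<and> S \<omega> < x + \<eta>)"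
  proof (rule abs_prob_diff_le)
    show "AE \<omega> in M. (\<omega> \<in> {\<omega> \<in> space M. T \<omega> \<le> real n}) \<noteq> (\<omega> \<in> {\<omega> \<in> space M. exp_series E \<omega> < x}) \<longrightarrow>
        \<omega> \<in> {\<omega> \<in> space M. \<eta> \<le> coupling_error k \<omega>} \<union> {\<omega> \<in> space M. x - \<eta> < S \<omega> \<and> S \<omega> < x + \<eta>}"
      using AE_coupling_error[of k, folded T_def S_def]
    proof eventually_elim
      case (elim \<omega>)
      \<comment> \<open>Both quantities are at distance less than \<eta> from
        \<open>S \<omega>\<close> and lie on different sides of \<open>x\<close>.\<close>
      have "x - \<eta> < S \<omega> \<and> S \<omega> < x + \<eta>"
        if "coupling_error k \<omega> < \<eta>" "T \<omega> / 2 ^ k \<le> x \<longleftrightarrow> \<not> exp_series E \<omega> < x"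
      proof (cases "exp_series E \<omega> < x")
        case True
        then have "x < T \<omega> / 2 ^ k" using that by auto
        with True elim that(1) show ?thesis unfolding T_def S_def by linarith
      next
        case False
        then have "T \<omega> / 2 ^ k \<le> x" using that by auto
        with False elim that(1) show ?thesis unfolding T_def S_def by linarith
      qed
      then show ?case unfolding T by auto
    qed
  qed measurable
  also have "\<P>(\<omega> in M. coupling_error k \<omega> \<ge> \<eta>) \<le> expectation (coupling_error k) / \<eta>"
    using integrable_coupling_error pos \<eta> by (intro integral_Markov_inequality_measure[of _ _ "{}"]) auto
  also have "expectation (coupling_error k) / \<eta> = (2 * real k + 1) * (3 / 4) ^ k"
  proof -
    have "(3 / 4 :: real) = (1 / 2) / (2 / 3)" by simp
    then show ?thesis
      by (simp only: expectation_coupling_error \<eta>_def power_divide) (simp add: field_simps)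
  qed
  also have "\<P>(\<omega> in M. x - \<eta> < S \<omega> \<and> S \<omega> < x + \<eta>) \<le> 2 * ((x + \<eta>) - (x - \<eta>))"
    using prob_partial_sum_interval_le[of k "x - \<eta>" "x + \<eta>"] False \<eta> by (simp add: S_def)
  finally show ?thesis
    by (simp add: reach_prob_eq T_def x_def \<eta>_def)
qed

text \<open>For fixed \<open>k\<close> the total waiting time is a single real random variable that
  does not depend on \<open>n\<close>.\<close>

lemma reach_prob_tendsto_1: "(\<lambda>n. reach_prob n k) \<longlonglongrightarrow> 1"
proof (rule tendsto_sandwich[OF _ _ _ tendsto_const])
  let ?T = "\<lambda>\<omega>. \<Sum>i=1..k. waiting_time k i (E i \<omega>)"
  show "(\<lambda>n. \<P>(\<omega> in M. ?T \<omega> < real n)) \<longlonglongrightarrow> 1"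
    by (intro prob_less_tendsto_1 filterlim_real_sequentially measurable_sum_waiting_time)
  have "{\<omega> \<in> space M. ?T \<omega> \<le> real n} \<in> events" for n
    by measurable
  then have "\<P>(\<omega> in M. ?T \<omega> < real n) \<le> \<P>(\<omega> in M. ?T \<omega> \<le> real n)" for n
    by (intro finite_measure_mono) auto
  then show "\<forall>\<^sub>F n in sequentially. \<P>(\<omega> in M. ?T \<omega> < real n) \<le> reach_prob n k"
    by (simp add: reach_prob_eq)
  show "\<forall>\<^sub>F n in sequentially. reach_prob n k \<le> 1"
    by (simp add: reach_prob_eq)
qed

section \<open>Summation over all sizes\<close>

lemma exp_series_prob_eq:
  "exp_series_prob M E n k =
     \<P>(\<omega> in M. exp_series E \<omega> < real n / 2 ^ k) - \<P>(\<omega> in M. exp_series E \<omega> < real n / 2 ^ Suc k)"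
proof -
  let ?L = "\<lambda>k. {\<omega> \<in> space M. exp_series E \<omega> < real n / 2 ^ k}"
  have "real n / 2 ^ Suc k \<le> real n / 2 ^ k"
    by (intro divide_left_mono) auto
  then have sub: "?L (Suc k) \<subseteq> ?L k" by auto
  have "{\<omega> \<in> space M. real n / 2 ^ (k + 1) \<le> exp_series E \<omega> \<and> exp_series E \<omega> < real n / 2 ^ k} =
      ?L k - ?L (Suc k)"
    by auto
  moreover have "prob (?L k - ?L (Suc k)) = prob (?L k) - prob (?L (Suc k))"
    by (rule finite_measure_Diff[OF _ _ sub]) measurable
  ultimately show ?thesis
    unfolding exp_series_prob_def by metis
qed

text \<open>Each term is the absolute difference of the approximation errors at \<open>k\<close> and
  \<open>Suc k\<close>. It is dominated by a summable sequence independent of \<open>n\<close> and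
  vanishes in the limit for fixed \<open>k\<close>, so Tannery's theorem applies.\<close>

lemma greedy_prob_tendsto_exp_series_prob:
  "summable (\<lambda>k. \<bar>greedy_prob n k - exp_series_prob M E n k\<bar>)"
  "(\<lambda>n. \<Sum>k. \<bar>greedy_prob n k - exp_series_prob M E n k\<bar>) \<longlonglongrightarrow> 0"
proof -
  define F where "F = (\<lambda>n k. \<P>(\<omega> in M. exp_series E \<omega> < real n / 2 ^ k))"
  define \<epsilon> :: "nat \<Rightarrow> real" where "\<epsilon> = (\<lambda>k. (2 * real k + 1) * (3 / 4) ^ k + 4 * (2 / 3) ^ k)"
  define d where "d = (\<lambda>k n. \<bar>greedy_prob n k - exp_series_prob M E n k\<bar>)"
  have d: "d k n = \<bar>(reach_prob n k - F n k) - (reach_prob n (Suc k) - F n (Suc k))\<bar>" for k n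
    by (simp add: d_def greedy_prob_eq exp_series_prob_eq F_def algebra_simps)
  have bound: "norm (d k n) \<le> \<epsilon> k + \<epsilon> (Suc k)" for k n
    using reach_prob_approx[of n k] reach_prob_approx[of n "Suc k"]
    unfolding d F_def \<epsilon>_def real_norm_def abs_abs by linarith
  \<comment> \<open>Writing \<open>2 * k + 1\<close> as \<open>2 * Suc k - 1\<close> brings in the
    differentiated geometric series.\<close>
  have "summable (\<lambda>k. 2 * (real (Suc k) * (3 / 4) ^ k) - (3 / 4) ^ k + 4 * (2 / 3 :: real) ^ k)"
    using geometric_deriv_sums[of "3 / 4 :: real"]
    by (intro summable_add summable_diff summable_mult summable_geometric) (auto simp: sums_iff)
  also have "(\<lambda>k. 2 * (real (Suc k) * (3 / 4) ^ k) - (3 / 4) ^ k + 4 * (2 / 3 :: real) ^ k) = \<epsilon>"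
    by (simp add: \<epsilon>_def fun_eq_iff algebra_simps)
  finally have "summable \<epsilon>" .
  then have sum: "summable (\<lambda>k. \<epsilon> k + \<epsilon> (Suc k))"
    by (intro summable_add) (simp_all add: summable_Suc_iff)
  show "summable (\<lambda>k. \<bar>greedy_prob n k - exp_series_prob M E n k\<bar>)"
    by (rule summable_comparison_test'[OF sum, of 0]) (use bound[of _ n] in \<open>simp add: d_def\<close>)
  have F_lim: "(\<lambda>n. F n k) \<longlonglongrightarrow> 1" for k
    unfolding F_def
  proof (rule prob_less_tendsto_1)
    show "filterlim (\<lambda>n. real n / 2 ^ k) at_top sequentially"
      unfolding divide_inverse
      by (rule filterlim_at_top_mult_tendsto_pos[OF tendsto_const _ filterlim_real_sequentially]) simp
  qed measurable
  have lim: "(\<lambda>n. d k n) \<longlonglongrightarrow> 0" for k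
  proof -
    have "(\<lambda>n. d k n) \<longlonglongrightarrow> \<bar>(1 - 1) - (1 - 1)\<bar>"
      unfolding d by (intro tendsto_intros reach_prob_tendsto_1 F_lim)
    then show ?thesis by simp
  qed
  have "(\<lambda>n. suminf (\<lambda>k. d k n)) \<longlonglongrightarrow> suminf (\<lambda>_. 0)"
    using tannerys_theorem[of d "\<lambda>_. 0" sequentially, OF lim _ sum] bound
    by (simp add: always_eventually case_prod_beta)
  then show "(\<lambda>n. \<Sum>k. \<bar>greedy_prob n k - exp_series_prob M E n k\<bar>) \<longlonglongrightarrow> 0"
    by (simp add: d_def)
qed

end

text \<open>The first conjunct guarantees that the infinite sum in the second is a genuine limit for
  every \<open>n \<ge> 1\<close>, as \<open>suminf\<close> is unspecified on divergent
  series.\<close>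

theorem theorem2:
  fixes M :: "'a measure" and E :: "nat \<Rightarrow> 'a \<Rightarrow> real"
  assumes "prob_space M"
    and "prob_space.indep_vars M (\<lambda>_. borel) E {1..}"
    and "\<And>i. i \<ge> 1 \<Longrightarrow> distributed M lborel (E i) (exponential_density (2 ^ i))"
  shows "(\<forall>n\<ge>1. summable (\<lambda>k. \<bar>greedy_prob n k - exp_series_prob M E n k\<bar>)) \<and>
         (\<lambda>n. \<Sum>k. \<bar>greedy_prob n k - exp_series_prob M E n k\<bar>) \<in> o(\<lambda>_. 1)"
proof -
  interpret prob_space M by fact
  interpret dyadic_exponentials M E
    using assms(2,3) by unfold_locales
  show ?thesis
    using greedy_prob_tendsto_exp_series_prob by (auto intro!: smalloI_tendsto)
qed

end
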